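(* (i) If $0\le B<A\le1$, then $R_{\mathscr{S}^*_{\wp,n}}(\mathcal{S}^*_n[A,B])=R_1:=\min\left\{1,\left(\frac{1/e}{A-(1-1/e)B}\right)^{1/n}\right\}$. (ii) If $-1\le B<0\le A\le1$, let $R_1$ be as in (i), $R_2=\min\{1,(e/(A-(e+1)B))^{1/n}\}$ and $r_1=\left(\frac{(e^2-1)/(2e)}{((e^2+2e-1)/(2e))B^2-AB}\right)^{1/(2n)}$. Then $R_{\mathscr{S}^*_{\wp,n}}(\mathcal{S}^*_n[A,B])=R_1$ if $R_1\le r_1$ and $=R_2$ if $R_1>r_1$. In particular, $R_{\mathscr{S}^*_\wp}(\mathcal{S}^* )=1/(2e-1)$. The radii are sharp.
   Context: $\mathbb{D}$ is the unit disk. For $n\ge1$, $\mathcal{A}_n$ is the class of analytic $f$ on $\mathbb{D}$ of the form $f(z)=z+\sum_{k\ge n+1}b_kz^k$, $\mathcal{A}=\mathcal{A}_1$. $f\prec g$ means $f=g\circ\omega$ for analytic $\omega:\mathbb{D}\to\mathbb{D}$, $\omega(0)=0$. $\wp(z)=1+ze^z$, $\mathscr{S}^*_\wp=\{f\in\mathcal{A}:zf'/f\prec\wp\}$, $\mathscr{S}^*_{\wp,n}=\mathcal{A}_n\cap\mathscr{S}^*_\wp$. $\mathcal{S}^*_n[A,B]=\{f\in\mathcal{A}_n: zf'(z)/f(z)\prec(1+Az)/(1+Bz)\}$, and $\mathcal{S}^*$ is the class of starlike functions $\{f\in\mathcal{A}:\operatorname{Re}(zf'/f)>0\}$ ($=\mathcal{S}^*_1[1,-1]$).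 For classes $G_1,G_2$, $R_{G_1}(G_2)$ is the largest $r_0\in(0,1]$ such that $r^{-1}f(rz)\in G_1$ for all $0<r\le r_0$ and all $f\in G_2$; "sharp" means it cannot be increased. *)

theory Defs
  imports "HOL-Analysis.Analysis"
begin

definition unit_disk :: "complex set" where
  "unit_disk = ball 0 1"

text \<open>The class A_n: analytic f on the disk with f(z) = z + sum_{k>=n+1} b_k z^k,
  i.e. f(0)=0, f'(0)=1 and the Taylor coefficients of orders 2..n vanish.\<close>
definition class_A :: "nat \<Rightarrow> (complex \<Rightarrow> complex) set" where
  "class_A n = {f. f holomorphic_on unit_disk \<and> f 0 = 0 \<and> deriv f 0 = 1 \<and>
                   (\<forall>k\<in>{2..n}. (deriv ^^ k) f 0 = 0)}"

definition subordinate :: "(complex \<Rightarrow> complex) \<Rightarrow> (complex \<Rightarrow> complex) \<Rightarrow> bool" where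
  "subordinate f g \<longleftrightarrow> (\<exists>\<omega>. \<omega> holomorphic_on unit_disk \<and> \<omega> ` unit_disk \<subseteq> unit_disk \<and>
      \<omega> 0 = 0 \<and> (\<forall>z\<in>unit_disk. f z = g (\<omega> z)))"

text \<open>The function z f'(z)/f(z), with its removable value 1 at z = 0 (for f in A_n).\<close>
definition zfq :: "(complex \<Rightarrow> complex) \<Rightarrow> complex \<Rightarrow> complex" where
  "zfq f z = (if z = 0 then 1 else z * deriv f z / f z)"

definition wp :: "complex \<Rightarrow> complex" where
  "wp z = 1 + z * exp z"

definition class_S_wp :: "nat \<Rightarrow> (complex \<Rightarrow> complex) set" where
  "class_S_wp n = {f \<in> class_A n. subordinate (zfq f) wp}"

definition class_S_AB :: "nat \<Rightarrow> real \<Rightarrow> real \<Rightarrow> (complex \<Rightarrow> complex) set" where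
  "class_S_AB n A B = {f \<in> class_A n.
      subordinate (zfq f) (\<lambda>z. (1 + of_real A * z) / (1 + of_real B * z))}"

definition class_Sstar :: "(complex \<Rightarrow> complex) set" where
  "class_Sstar = {f \<in> class_A 1. \<forall>z\<in>unit_disk. Re (zfq f z) > 0}"

definition dilate :: "real \<Rightarrow> (complex \<Rightarrow> complex) \<Rightarrow> complex \<Rightarrow> complex" where
  "dilate r f = (\<lambda>z. f (of_real r * z) / of_real r)"

definition radius_ok :: "(complex \<Rightarrow> complex) set \<Rightarrow> (complex \<Rightarrow> complex) set \<Rightarrow> real \<Rightarrow> bool" where
  "radius_ok G1 G2 r0 \<longleftrightarrow> (\<forall>r. 0 < r \<and> r \<le> r0 \<longrightarrow> (\<forall>f\<in>G2. dilate r f \<in> G1))"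

definition is_radius :: "(complex \<Rightarrow> complex) set \<Rightarrow> (complex \<Rightarrow> complex) set \<Rightarrow> real \<Rightarrow> bool" where
  "is_radius G1 G2 R \<longleftrightarrow> 0 < R \<and> R \<le> 1 \<and> radius_ok G1 G2 R \<and>
      (\<forall>R'. R < R' \<and> R' \<le> 1 \<longrightarrow> \<not> radius_ok G1 G2 R')"

end

theory Submission
  imports Defs "HOL-Complex_Analysis.Complex_Analysis"
begin

text \<open>
  Write \<open>h(z) = z e\<^sup>z\<close>, so that \<open>\<wp> = 1 + h\<close>. On the unit circle \<open>\<bar>h - sinh 1\<bar> \<ge> cosh 1\<close>, which
  amounts to \<open>sinh x \<ge> sinh 1 (x cos y - y sin y)\<close> for \<open>x\<^sup>2 + y\<^sup>2 = 1\<close>; hence the image of the unit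
  disk under \<open>\<wp>\<close> contains the disk with diameter \<open>(1 - 1/e, 1 + e)\<close>, while by univalence and
  symmetry its real points are exactly this interval. If \<open>f\<close> is in \<open>S\<^sup>*\<^sub>n[A,B]\<close> then
  \<open>z f'/f = (1 + A \<omega>)/(1 + B \<omega>)\<close> with \<open>\<bar>\<omega>(z)\<bar> \<le> \<bar>z\<bar>\<^sup>n\<close>, so on \<open>\<bar>z\<bar> < R\<close> the values lie in a disk
  symmetric about the real axis. Such a disk is contained in the one above iff its two real end
  points are, and these are attained by the function with \<open>\<omega>(z) = z\<^sup>n\<close>. So \<open>R\<close> is the
  radius as soon as both end points satisfy their bound at \<open>R\<close> and one of them attains it (or
  \<open>R = 1\<close>). Which end point is critical is decided by the position of the centre of the disk
  relative to \<open>1 + sinh 1\<close>.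
\<close>

section \<open>The image of the unit disk under \<open>z e\<^sup>z\<close>\<close>

lemma cos_ge_quadratic: "1 - t\<^sup>2 / 2 \<le> cos t" for t :: real
proof -
  have "(sin (t/2))\<^sup>2 \<le> (t/2)\<^sup>2"
    using abs_sin_x_le_abs_x[of "t/2"] abs_le_square_iff by blast
  moreover have "cos t = 1 - 2 * (sin (t/2))\<^sup>2"
    using cos_double_sin[of "t/2"] by simp
  ultimately show ?thesis by (simp add: power_divide)
qed

lemma x_sin_x_ge: "x\<^sup>2 / 2 \<le> x * sin x" if "\<bar>x\<bar> \<le> 1" for x :: real
proof -
  have pos: "x / 2 \<le> sin x" if x: "0 \<le> x" "x \<le> 1" for x :: real
  proof -
    have "sin 0 - 0 / 2 \<le> sin x - x / 2"
    proof (rule DERIV_nonneg_imp_nondecreasing[OF x(1)])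
      fix y :: real assume y: "0 \<le> y" "y \<le> x"
      have "y\<^sup>2 \<le> 1" using y x by (simp add: power_le_one)
      then have "0 \<le> cos y - 1/2" using cos_ge_quadratic[of y] by linarith
      then show "\<exists>d. ((\<lambda>x. sin x - x / 2) has_real_derivative d) (at y) \<and> 0 \<le> d"
        by (intro exI[of _ "cos y - 1/2"]) (auto intro!: derivative_eq_intros)
    qed
    then show ?thesis by simp
  qed
  have "\<bar>x\<bar> * (\<bar>x\<bar> / 2) \<le> \<bar>x\<bar> * sin \<bar>x\<bar>"
    by (intro mult_left_mono pos) (use that in auto)
  moreover have "\<bar>x\<bar> * sin \<bar>x\<bar> = x * sin x" by (auto simp: abs_if)
  ultimately show ?thesis by (simp add: power2_eq_square)
qed

lemma sinh_le_x_cosh: "sinh x \<le> x * cosh x" if "0 \<le> x" for x :: real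
proof -
  have "0 * cosh 0 - sinh 0 \<le> x * cosh x - sinh x"
  proof (rule DERIV_nonneg_imp_nondecreasing[OF that])
    fix y :: real assume y: "0 \<le> y" "y \<le> x"
    show "\<exists>d. ((\<lambda>x. x * cosh x - sinh x) has_real_derivative d) (at y) \<and> 0 \<le> d"
      by (intro exI[of _ "y * sinh y"]) (use y in \<open>auto intro!: derivative_eq_intros\<close>)
  qed
  then show ?thesis by simp
qed

text \<open>The hyperbolic companion of \<open>cos_ge_quadratic\<close>. The product is even, equals
  1 at 0 and does not increase for \<open>t \<ge> 0\<close>.\<close>

lemma cosh_times_quadratic_le_1: "cosh t * (1 - t\<^sup>2 / 2) \<le> 1" for t :: real
proof -
  have pos: "cosh t * (1 - t\<^sup>2 / 2) \<le> 1" if t: "0 \<le> t" for t :: real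
  proof -
    have "cosh t * (1 - t\<^sup>2 / 2) \<le> cosh 0 * (1 - 0\<^sup>2 / 2)"
    proof (rule DERIV_nonpos_imp_nonincreasing[OF t])
      fix y :: real assume y: "0 \<le> y" "y \<le> t"
      have "sinh y * (1 - y\<^sup>2 / 2) \<le> sinh y * 1"
        by (intro mult_left_mono) (use y in auto)
      then have "sinh y * (1 - y\<^sup>2 / 2) - y * cosh y \<le> 0"
        using sinh_le_x_cosh[OF y(1)] by linarith
      moreover have "((\<lambda>x. cosh x * (1 - x\<^sup>2 / 2)) has_real_derivative
          sinh y * (1 - y\<^sup>2 / 2) - y * cosh y) (at y)"
        by (auto intro!: derivative_eq_intros)
      ultimately show "\<exists>d. ((\<lambda>x. cosh x * (1 - x\<^sup>2 / 2)) has_real_derivative d) (at y) \<and> d \<le> 0"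
        by blast
    qed
    then show ?thesis by simp
  qed
  show ?thesis
    using pos[of t] pos[of "-t"] by (cases "0 \<le> t") auto
qed

lemma convex_on_sinh: "convex_on {0..} (sinh :: real \<Rightarrow> real)"
  by (rule convex_on_realI[where f' = cosh]) (auto intro!: derivative_eq_intros simp: cosh_real_nonneg_le_iff)

text \<open>With \<open>e = exp 1\<close>, the inequality
  \<open>cosh 1 - sinh 1 \<le> sinh 1 / 2\<close> is exactly \<open>e^2 \<ge> 5\<close>.\<close>

lemma five_le_exp_1_square: "5 \<le> (exp 1 :: real)\<^sup>2"
proof -
  have "(5/2)\<^sup>2 \<le> (exp 1 :: real)\<^sup>2"
    using exp_lower_Taylor_quadratic[of "1::real"] by (intro power_mono) auto
  then show ?thesis by (simp add: power2_eq_square)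
qed

text \<open>Equality holds at \<open>x = 1\<close> and \<open>x = -1\<close>, so the estimates of
  \<open>sinh\<close> have to be exact there: convexity supplies the tangent at 1 for
  \<open>x \<ge> 0\<close> and, by oddness, the chord from 0 to 1 for \<open>x < 0\<close>.\<close>

lemma sinh_ge_on_circle:
  fixes x y :: real
  assumes "x\<^sup>2 + y\<^sup>2 = 1"
  shows "sinh 1 * (x * cos y - y * sin y) \<le> sinh x"
proof -
  have y2: "y\<^sup>2 \<le> 1" "x\<^sup>2 \<le> 1" using assms by (smt (verit) zero_le_power2)+
  then have y1: "\<bar>y\<bar> \<le> 1" "\<bar>x\<bar> \<le> 1" using abs_square_le_1 by blast+
  have ys: "y\<^sup>2 / 2 \<le> y * sin y" using x_sin_x_ge y1 by blast
  have s0: "0 < sinh (1::real)" by simp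
  show ?thesis
  proof (cases "0 \<le> x")
    case True
    have tangent: "sinh x \<ge> sinh 1 - cosh 1 * (1 - x)"
    proof -
      have "sinh x - sinh 1 \<ge> cosh 1 * (x - 1)"
        by (rule convex_on_imp_above_tangent[OF convex_on_sinh])
           (use True in \<open>auto intro!: derivative_eq_intros\<close>)
      then show ?thesis by (simp add: algebra_simps)
    qed
    have "x * cos y \<le> x * 1" by (intro mult_left_mono) (use True in auto)
    then have "x * cos y - y * sin y \<le> x - (1 - x\<^sup>2) / 2"
      using ys assms unfolding diff_divide_distrib by linarith
    also have "\<dots> = x - (1 - x) * (1 + x) / 2" by (simp add: power2_eq_square algebra_simps)
    finally have "sinh 1 * (x * cos y - y * sin y) \<le> sinh 1 * (x - (1 - x) * (1 + x) / 2)"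
      using s0 by (intro mult_left_mono) auto
    \<comment> \<open>The tangent value minus the upper bound just found, with the common factor
      \<open>1 - x\<close> taken out.\<close>
    moreover have "0 \<le> (1 - x) * (sinh 1 - cosh 1 + sinh 1 * (1 + x) / 2)"
    proof (intro mult_nonneg_nonneg)
      have "cosh 1 - sinh 1 \<le> sinh (1::real) / 2"
        using five_le_exp_1_square by (simp add: sinh_field_def cosh_field_def exp_minus field_simps power2_eq_square)
      moreover have "sinh 1 * 1 \<le> sinh 1 * (1 + x)" using s0 True by (intro mult_left_mono) auto
      ultimately show "0 \<le> sinh 1 - cosh 1 + sinh 1 * (1 + x) / 2" by linarith
    qed (use y1 in auto)
    ultimately show ?thesis using tangent by (simp add: algebra_simps)
  next
    case False
    define X where "X = - x"
    have X: "0 \<le> X" "X \<le> 1" using False y1 by (auto simp: X_def)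
    have "sinh ((1 - X) *\<^sub>R 0 + X *\<^sub>R 1) \<le> (1 - X) * sinh 0 + X * sinh 1"
      by (rule convex_onD[OF convex_on_sinh]) (use X in auto)
    then have chord: "sinh X \<le> sinh 1 * X" by (simp add: mult.commute)
    have "X * (1 - cos y) \<le> 1 * (y\<^sup>2 / 2)"
      by (intro mult_mono) (use X cos_ge_quadratic[of y] in auto)
    then have "X \<le> X * cos y + y * sin y" using ys by (simp add: algebra_simps)
    then have "sinh 1 * X \<le> sinh 1 * (X * cos y + y * sin y)"
      using s0 by (intro mult_left_mono) auto
    then show ?thesis using chord by (simp add: X_def algebra_simps)
  qed
qed

text \<open>For two points with the same image, \<open>z + w\<close> is determined by
  \<open>d = z - w\<close>, and the parallelogram law bounds the sum of their squared norms by 4.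
  Eliminating \<open>z + w\<close> leaves \<open>cos b < cosh a * (1 - (a^2 + b^2) / 2)\<close> for
  \<open>d = a + i b\<close>, which the quadratic bounds for \<open>cos\<close> and
  \<open>cosh\<close> refute.\<close>

lemma inj_on_z_exp: "inj_on (\<lambda>z::complex. z * exp z) (ball 0 1)"
proof (rule inj_onI, rule ccontr)
  fix z w :: complex
  assume zw: "z \<in> ball 0 1" "w \<in> ball 0 1" and eq: "z * exp z = w * exp w" and ne: "z \<noteq> w"
  define d where "d = z - w"
  define a b where "a = Re d" and "b = Im d"
  define E where "E = exp d"
  have zE: "z * E = w"
    using eq by (simp add: E_def d_def exp_diff field_simps)
  \<comment> \<open>Solving for the half-sum; its factor is essentially \<open>coth (d/2)\<close>.\<close>
  have sum_eq: "(z + w) * (E - 1) = - d * (E + 1)"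
    using zE by (simp add: d_def algebra_simps)
  have E1: "E \<noteq> 1"
    using sum_eq ne by (auto simp: d_def)
  have par: "(norm (z + w))\<^sup>2 + (norm d)\<^sup>2 < 4"
  proof -
    have "(norm (z + w))\<^sup>2 + (norm d)\<^sup>2 = 2 * ((norm z)\<^sup>2 + (norm w)\<^sup>2)"
      unfolding d_def cmod_power2 by (simp add: power2_eq_square algebra_simps)
    moreover have "(norm z)\<^sup>2 < 1" "(norm w)\<^sup>2 < 1" using zw by (simp_all add: abs_square_less_1)
    ultimately show ?thesis by simp
  qed
  have "(norm d)\<^sup>2 * ((norm (E + 1))\<^sup>2 + (norm (E - 1))\<^sup>2)
      = ((norm (z + w))\<^sup>2 + (norm d)\<^sup>2) * (norm (E - 1))\<^sup>2"
  proof -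
    have "(norm (z + w))\<^sup>2 * (norm (E - 1))\<^sup>2 = (norm d)\<^sup>2 * (norm (E + 1))\<^sup>2"
      using arg_cong[OF sum_eq, of "\<lambda>u. (norm u)\<^sup>2"]
      unfolding norm_mult power_mult_distrib norm_minus_cancel .
    then show ?thesis unfolding distrib_left distrib_right by simp
  qed
  also have "\<dots> < 4 * (norm (E - 1))\<^sup>2"
    using par E1 by (intro mult_strict_right_mono) auto
  finally have lt: "(norm d)\<^sup>2 * ((norm (E + 1))\<^sup>2 + (norm (E - 1))\<^sup>2) < 4 * (norm (E - 1))\<^sup>2" .
  define q where "q = exp a"
  have q: "q > 0" by (simp add: q_def)
  have Esq: "(Re E)\<^sup>2 + (Im E)\<^sup>2 = q\<^sup>2"
    by (simp flip: cmod_power2 add: E_def q_def a_def norm_exp_eq_Re)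
  have ReE: "Re E = q * cos b" by (simp add: E_def q_def a_def b_def Re_exp)
  have plus: "(norm (E + 1))\<^sup>2 = q\<^sup>2 + 1 + 2 * q * cos b"
    and minus: "(norm (E - 1))\<^sup>2 = q\<^sup>2 + 1 - 2 * q * cos b"
    unfolding cmod_power2 using Esq ReE by (simp_all add: power2_sum power2_diff)
  have nd: "(norm d)\<^sup>2 = a\<^sup>2 + b\<^sup>2" by (simp add: a_def b_def cmod_power2)
  have key: "cosh a * (1 - (a\<^sup>2 + b\<^sup>2) / 2) \<le> cos b"
  proof -
    have "b\<^sup>2 / 2 \<le> cosh a * (b\<^sup>2 / 2)"
      using mult_right_mono[OF cosh_real_ge_1[of a], of "b\<^sup>2 / 2"] by simp
    then have "cosh a * (1 - a\<^sup>2 / 2) - cosh a * (b\<^sup>2 / 2) \<le> 1 - b\<^sup>2 / 2"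
      using cosh_times_quadratic_le_1[of a] by linarith
    then show ?thesis using cos_ge_quadratic[of b] by (simp add: algebra_simps add_divide_distrib)
  qed
  have cq: "2 * q * cosh a = q\<^sup>2 + 1"
    by (simp add: q_def cosh_field_def exp_minus field_simps power2_eq_square)
  have "(2 * q) * (cosh a * (1 - (a\<^sup>2 + b\<^sup>2) / 2)) \<le> (2 * q) * cos b"
    using key q by (intro mult_left_mono) auto
  then have "(q\<^sup>2 + 1) * (1 - (a\<^sup>2 + b\<^sup>2) / 2) \<le> 2 * q * cos b"
    by (simp add: mult.assoc flip: cq)
  then show False
    using lt by (simp add: plus minus nd field_simps)
qed

text \<open>The map commutes with conjugation, so injectivity forces the preimage of a real number
  to be real; what remains is the range of \<open>x * exp x\<close> for
  \<open>\<bar>x\<bar> < 1\<close>.\<close>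

lemma z_exp_real_bounds:
  fixes z :: complex and u :: real
  assumes z: "z \<in> ball 0 1" and eq: "z * exp z = of_real u"
  shows "- exp (-1) < u" and "u < exp 1"
proof -
  have "cnj z * exp (cnj z) = of_real u"
    using arg_cong[OF eq, of cnj] by (simp add: exp_cnj)
  then have "cnj z * exp (cnj z) = z * exp z" using eq by simp
  then have "cnj z = z"
    using inj_onD[OF inj_on_z_exp, of "cnj z" z] z by simp
  then obtain x :: real where x: "z = of_real x" by (metis Reals_cases Reals_cnj_iff)
  then have x1: "\<bar>x\<bar> < 1" using z by simp
  have ux: "u = x * exp x"
    using eq unfolding x by (metis exp_of_real of_real_eq_iff of_real_mult)
  have "1 + (-1 - x) < exp (-1 - x)"
    using x1 exp_minus_greater[of "1 + x"] by simp
  then have "- x * exp x < exp (-1 - x) * exp x" by (intro mult_strict_right_mono) auto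
  then show "- exp (-1) < u" by (simp add: ux flip: exp_add)
  have "x * exp x \<le> \<bar>x\<bar> * exp x" by (intro mult_right_mono) auto
  also have "\<dots> < 1 * exp 1" by (intro mult_strict_mono) (use x1 in auto)
  finally show "u < exp 1" by (simp add: ux)
qed

text \<open>The ball has the diameter from \<open>-1/e\<close> to \<open>e\<close>. It is connected
  and misses the image of the unit circle, so the part of it covered by the image of the disk is
  open and closed in it; that part contains 0.\<close>

lemma ball_subset_z_exp_image:
  "ball (of_real (sinh 1)) (cosh 1) \<subseteq> (\<lambda>z::complex. z * exp z) ` ball 0 1"
    (is "?\<Delta> \<subseteq> ?h ` _")
proof -
  have boundary: "?h z \<notin> ?\<Delta>" if z: "norm z = 1" for z
  proof -
    define x y where "x = Re z" and "y = Im z"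
    have xy: "x\<^sup>2 + y\<^sup>2 = 1" using z by (simp add: x_def y_def flip: cmod_power2)
    have "Re (?h z) = exp x * (x * cos y - y * sin y)"
      by (simp add: x_def y_def Re_exp Im_exp algebra_simps)
    moreover have "(norm (?h z))\<^sup>2 = (exp x)\<^sup>2"
      by (simp add: norm_mult z x_def norm_exp_eq_Re)
    moreover have "(norm (?h z - of_real (sinh 1)))\<^sup>2
        = (norm (?h z))\<^sup>2 - 2 * sinh 1 * Re (?h z) + (sinh 1)\<^sup>2"
      unfolding cmod_power2 by (simp add: power2_eq_square algebra_simps)
    moreover have "(cosh (1::real))\<^sup>2 = (sinh 1)\<^sup>2 + 1" by (rule cosh_square_eq)
    \<comment> \<open>What remains of \<open>\<bar>h - sinh 1\<bar> \<ge> cosh 1\<close> once the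
      squares are expanded; division by \<open>2 * exp x\<close> turns it into
      \<open>sinh_ge_on_circle\<close>.\<close>
    moreover have "2 * sinh 1 * (exp x * (x * cos y - y * sin y)) \<le> (exp x)\<^sup>2 - 1"
    proof -
      have "2 * exp x * (sinh 1 * (x * cos y - y * sin y)) \<le> 2 * exp x * sinh x"
        using sinh_ge_on_circle[OF xy] by (intro mult_left_mono) auto
      also have "\<dots> = (exp x)\<^sup>2 - 1"
        by (simp add: sinh_field_def exp_minus field_simps power2_eq_square)
      finally show ?thesis by (simp add: mult_ac)
    qed
    ultimately have "(cosh 1)\<^sup>2 \<le> (norm (?h z - of_real (sinh 1)))\<^sup>2" by simp
    then have "cosh 1 \<le> norm (?h z - of_real (sinh 1))"
      using power2_le_imp_le norm_ge_zero by blast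
    then show ?thesis by (simp add: dist_norm norm_minus_commute)
  qed
  have "open (?h ` ball 0 1)"
    by (rule open_mapping_thm3[OF _ _ inj_on_z_exp]) (auto intro!: holomorphic_intros)
  moreover have "closed (?h ` cball 0 1)"
    by (intro compact_imp_closed compact_continuous_image continuous_intros) auto
  moreover have "?\<Delta> \<inter> ?h ` cball 0 1 = ?\<Delta> \<inter> ?h ` ball 0 1"
  proof -
    have "z \<in> ball 0 1" if "z \<in> cball 0 1" "?h z \<in> ?\<Delta>" for z
      using boundary[of z] that by (cases "norm z = 1") auto
    then show ?thesis by auto
  qed
  ultimately have "openin (top_of_set ?\<Delta>) (?\<Delta> \<inter> ?h ` ball 0 1)"
    and "closedin (top_of_set ?\<Delta>) (?\<Delta> \<inter> ?h ` ball 0 1)"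
    by (metis openin_open, metis closedin_closed)
  moreover have "0 \<in> ?\<Delta> \<inter> ?h ` ball 0 1"
  proof -
    have "norm (complex_of_real (sinh 1)) < cosh 1"
      using sinh_less_cosh_real[of 1] by simp
    moreover have "?h 0 = 0" by simp
    ultimately show ?thesis by (force simp del: norm_of_real)
  qed
  moreover have "connected ?\<Delta>" by simp
  ultimately show ?thesis
    unfolding connected_clopen by blast
qed

section \<open>The classes \<open>A\<^sub>n\<close> and \<open>S\<^sup>*\<^sub>n[A,B]\<close>\<close>

text \<open>The derivative of \<open>z^m G\<close> is \<open>z^(m-1) (m G + z G')\<close>, of the
  same shape with a new cofactor that equals \<open>m G(0)\<close> at 0. Hence the induction on
  \<open>k\<close> with \<open>F\<close>, \<open>G\<close> and \<open>m\<close> all varying.\<close>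

lemma higher_deriv_power_mult:
  fixes F G :: "complex \<Rightarrow> complex"
  assumes "G holomorphic_on unit_disk" "\<And>z. z \<in> unit_disk \<Longrightarrow> F z = z ^ m * G z" "k \<le> m"
  shows "(deriv ^^ k) F 0 = (if k < m then 0 else fact m * G 0)"
  using assms
proof (induction k arbitrary: F G m)
  case 0
  then show ?case by (auto simp: unit_disk_def)
next
  case (Suc k)
  then obtain m' where m: "m = Suc m'" by (cases m) auto
  define H where "H = (\<lambda>z. of_nat m * G z + z * deriv G z)"
  have H: "H holomorphic_on unit_disk"
    unfolding H_def by (intro holomorphic_intros holomorphic_deriv Suc.prems)
      (auto simp: unit_disk_def)
  have "deriv F z = z ^ m' * H z" if z: "z \<in> unit_disk" for z
  proof (rule DERIV_imp_deriv)
    have "(G has_field_derivative deriv G z) (at z)"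
      by (rule holomorphic_derivI[OF Suc.prems(1) _ z]) (auto simp: unit_disk_def)
    then have "((\<lambda>z. z ^ Suc m' * G z) has_field_derivative
        (1 + of_nat m') * (1 * z ^ m') * G z + deriv G z * z ^ Suc m') (at z)"
      by (intro DERIV_mult DERIV_power_Suc DERIV_ident)
    then have "((\<lambda>z. z ^ m * G z) has_field_derivative z ^ m' * H z) (at z)"
      by (simp add: m H_def algebra_simps)
    then show "(F has_field_derivative z ^ m' * H z) (at z)"
      by (rule DERIV_cong_ev[THEN iffD1, rotated -1])
        (use z Suc.prems(2) in \<open>auto simp: unit_disk_def eventually_nhds intro!: exI[of _ "ball 0 1"]\<close>)
  qed
  then have "(deriv ^^ k) (deriv F) 0 = (if k < m' then 0 else fact m' * H 0)"
    using Suc.prems(3) by (intro Suc.IH[OF H]) (auto simp: m)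
  then show ?case
    by (simp add: funpow_swap1 H_def m algebra_simps del: funpow.simps add: funpow_Suc_right)
qed

lemma holomorphic_factor_zero:
  fixes F :: "complex \<Rightarrow> complex"
  assumes "F holomorphic_on unit_disk" "F 0 = 0"
  obtains G where "G holomorphic_on unit_disk" "\<And>z. z \<in> unit_disk \<Longrightarrow> F z = z * G z"
proof
  show "(\<lambda>z. if z = 0 then deriv F 0 else (F z - F 0) / (z - 0)) holomorphic_on unit_disk"
    by (rule pole_lemma_open[OF assms(1)]) (simp add: unit_disk_def)
qed (use assms(2) in auto)

text \<open>One factor \<open>z\<close> at a time: the next vanishing derivative is a factorial
  times the value of the current cofactor at 0, so that cofactor is divisible by \<open>z\<close>
  again.\<close>

lemma holomorphic_factor_power:
  fixes F :: "complex \<Rightarrow> complex"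
  assumes "F holomorphic_on unit_disk" "\<And>k. k < m \<Longrightarrow> (deriv ^^ k) F 0 = 0"
  shows "\<exists>G. G holomorphic_on unit_disk \<and> (\<forall>z\<in>unit_disk. F z = z ^ m * G z)"
  using assms(2)
proof (induction m)
  case 0
  then show ?case using assms(1) by auto
next
  case (Suc m)
  then obtain G where G: "G holomorphic_on unit_disk" "\<And>z. z \<in> unit_disk \<Longrightarrow> F z = z ^ m * G z"
    by auto
  have "fact m * G 0 = 0"
    using higher_deriv_power_mult[OF G, of m] Suc.prems[of m] by simp
  then obtain G' where "G' holomorphic_on unit_disk" "\<And>z. z \<in> unit_disk \<Longrightarrow> G z = z * G' z"
    using holomorphic_factor_zero[OF G(1)] by auto
  then show ?case using G(2) by (intro exI[of _ G']) (auto simp: mult_ac)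
qed

text \<open>Trades the derivative conditions for a factorization that is easy to dilate and compose.
  The derivatives of \<open>f z - z\<close> vanish in the orders 0 to \<open>n\<close>, hence the
  exponent \<open>Suc n\<close>.\<close>

lemma class_A_iff:
  assumes "n \<ge> 1"
  shows "f \<in> class_A n \<longleftrightarrow>
    (\<exists>G. G holomorphic_on unit_disk \<and> (\<forall>z\<in>unit_disk. f z = z + z ^ Suc n * G z))"
proof -
  have split: "(deriv ^^ k) (\<lambda>z. f z - z) 0 = (deriv ^^ k) f 0 - (if k = 1 then 1 else 0)"
    if "f holomorphic_on unit_disk" for k
    by (subst higher_deriv_diff[where S = unit_disk]) (use that in \<open>auto simp: unit_disk_def\<close>)
  show ?thesis
  proof
    assume f: "f \<in> class_A n"
    then have hol: "f holomorphic_on unit_disk" by (simp add: class_A_def)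
    have "(deriv ^^ k) (\<lambda>z. f z - z) 0 = 0" if "k < Suc n" for k
    proof -
      have "k = 0 \<or> k = 1 \<or> k \<in> {2..n}"
        unfolding atLeastAtMost_iff using that by linarith
      then show ?thesis unfolding split[OF hol] using f by (auto simp: class_A_def)
    qed
    with holomorphic_factor_power[OF holomorphic_on_diff[OF hol holomorphic_on_ident]]
    obtain G where "G holomorphic_on unit_disk" "\<forall>z\<in>unit_disk. f z - z = z ^ Suc n * G z"
      by blast
    then show "\<exists>G. G holomorphic_on unit_disk \<and> (\<forall>z\<in>unit_disk. f z = z + z ^ Suc n * G z)"
      by (auto simp: diff_eq_eq add.commute)
  next
    assume "\<exists>G. G holomorphic_on unit_disk \<and> (\<forall>z\<in>unit_disk. f z = z + z ^ Suc n * G z)"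
    then obtain G where G: "G holomorphic_on unit_disk"
      "\<And>z. z \<in> unit_disk \<Longrightarrow> f z = z + z ^ Suc n * G z" by auto
    have hol: "f holomorphic_on unit_disk"
      by (rule holomorphic_transform[of "\<lambda>z. z + z ^ Suc n * G z"])
        (use G in \<open>auto intro!: holomorphic_intros\<close>)
    have "(deriv ^^ k) (\<lambda>z. f z - z) 0 = 0" if "k \<le> n" for k
      using higher_deriv_power_mult[of G "\<lambda>z. f z - z" "Suc n" k] G that by auto
    then have d: "(deriv ^^ k) f 0 = (if k = 1 then 1 else 0)" if "k \<le> n" for k
      using that split[OF hol, of k] by simp
    show "f \<in> class_A n"
      unfolding class_A_def using hol d[of 0] d[of 1] d assms by auto
  qed
qed

lemma class_A_holomorphic: "f \<in> class_A n \<Longrightarrow> f holomorphic_on unit_disk"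
  by (simp add: class_A_def)

text \<open>With \<open>f = z g\<close> and \<open>g = 1 + z^n G\<close>, the quotient is
  \<open>1 + z g' / g\<close>, where \<open>z g' = z^n (n G + z G')\<close>.\<close>

lemma zfq_factor:
  assumes n: "n \<ge> 1" and f: "f \<in> class_A n"
    and nz: "\<And>z. z \<in> unit_disk \<Longrightarrow> z \<noteq> 0 \<Longrightarrow> f z \<noteq> 0"
  obtains K where "K holomorphic_on unit_disk" "\<And>z. z \<in> unit_disk \<Longrightarrow> zfq f z = 1 + z ^ n * K z"
proof -
  obtain G where G: "G holomorphic_on unit_disk"
    "\<And>z. z \<in> unit_disk \<Longrightarrow> f z = z + z ^ Suc n * G z"
    using f class_A_iff[OF n] by auto
  define g where "g = (\<lambda>z. 1 + z ^ n * G z)"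
  have fg: "f z = z * g z" if "z \<in> unit_disk" for z
    using G(2)[OF that] by (simp add: g_def algebra_simps)
  have g: "g z \<noteq> 0" if "z \<in> unit_disk" for z
    using nz[OF that] fg[OF that] n by (cases "z = 0") (auto simp: g_def power_0_left)
  define K where "K = (\<lambda>z. (of_nat n * G z + z * deriv G z) / g z)"
  have "K holomorphic_on unit_disk"
    unfolding K_def g_def by (intro holomorphic_intros holomorphic_deriv G)
      (use g in \<open>auto simp: unit_disk_def g_def\<close>)
  moreover have "zfq f z = 1 + z ^ n * K z" if z: "z \<in> unit_disk" for z
  proof (cases "z = 0")
    case True
    then show ?thesis using n by (simp add: zfq_def)
  next
    case False
    have "(G has_field_derivative deriv G z) (at z)"
      by (rule holomorphic_derivI[OF G(1) _ z]) (auto simp: unit_disk_def)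
    then have "((\<lambda>z. z + z ^ Suc n * G z) has_field_derivative
        1 + ((1 + of_nat n) * (1 * z ^ n) * G z + deriv G z * z ^ Suc n)) (at z)"
      by (intro DERIV_add DERIV_mult DERIV_power_Suc DERIV_ident)
    then have "((\<lambda>z. z + z ^ Suc n * G z) has_field_derivative
        g z + z ^ n * (of_nat n * G z + z * deriv G z)) (at z)"
      by (simp add: g_def algebra_simps)
    then have "(f has_field_derivative g z + z ^ n * (of_nat n * G z + z * deriv G z)) (at z)"
      by (rule DERIV_cong_ev[THEN iffD1, rotated -1])
        (use z G(2) in \<open>auto simp: unit_disk_def eventually_nhds intro!: exI[of _ "ball 0 1"]\<close>)
    then have "deriv f z = g z + z ^ n * (of_nat n * G z + z * deriv G z)"
      by (rule DERIV_imp_deriv)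
    then show ?thesis
      using False g[OF z] by (simp add: zfq_def fg[OF z] K_def field_simps)
  qed
  ultimately show ?thesis using that by blast
qed

text \<open>At a zero of \<open>f\<close> away from the origin \<open>zfq f\<close> has the junk value 0, so a holomorphic
  formula for \<open>zfq f\<close> is only an identity off the zeros and must first be continued across them.\<close>

lemma class_A_nonzero:
  assumes n: "n \<ge> 1" and f: "f \<in> class_A n" and p: "p holomorphic_on unit_disk"
    and eq: "\<And>z. z \<in> unit_disk \<Longrightarrow> zfq f z = p z"
    and z0: "z0 \<in> unit_disk" "z0 \<noteq> 0"
  shows "f z0 \<noteq> 0"
proof -
  have D: "open unit_disk" "convex unit_disk" "connected unit_disk" "0 \<in> unit_disk"
    by (auto simp: unit_disk_def)
  obtain G where G: "G holomorphic_on unit_disk"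
    "\<And>z. z \<in> unit_disk \<Longrightarrow> f z = z + z ^ Suc n * G z"
    using f class_A_iff[OF n] by auto
  define g where "g = (\<lambda>z. 1 + z ^ n * G z)"
  have fg: "f z = z * g z" if "z \<in> unit_disk" for z
    using G(2)[OF that] by (simp add: g_def algebra_simps)
  have g0: "g 0 = 1" using n by (simp add: g_def)
  have gh: "g holomorphic_on unit_disk"
    unfolding g_def by (intro holomorphic_intros G)
  have gd: "(g has_field_derivative deriv g z) (at z)" if "z \<in> unit_disk" for z
    by (rule holomorphic_derivI[OF gh D(1) that])
  have "(\<lambda>z. p z - 1) holomorphic_on unit_disk" "p 0 - 1 = 0"
    using eq[OF D(4)] p by (auto simp: zfq_def intro: holomorphic_intros)
  from holomorphic_factor_zero[OF this] obtain p1 where p1: "p1 holomorphic_on unit_disk"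
    "\<And>z. z \<in> unit_disk \<Longrightarrow> p z - 1 = z * p1 z"
    by blast
  define V where "V = {z \<in> unit_disk. g z \<noteq> 0}"
  have V: "open V"
  proof -
    have "open (unit_disk \<inter> g -` (- {0}))"
      by (intro continuous_open_preimage holomorphic_on_imp_continuous_on gh D) auto
    moreover have "unit_disk \<inter> g -` (- {0}) = V" by (auto simp: V_def)
    ultimately show ?thesis by simp
  qed
  have Vne: "V - {0} \<noteq> {}"
  proof
    assume "V - {0} = {}"
    then have "V = {0}" using g0 D(4) by (auto simp: V_def)
    then show False using V not_open_singleton by metis
  qed
  have odeV: "deriv g z = p1 z * g z" if z: "z \<in> V - {0}" for z
  proof -
    have zD: "z \<in> unit_disk" and z0: "z \<noteq> 0" "g z \<noteq> 0" using z by (auto simp: V_def)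
    have "((\<lambda>z. z * g z) has_field_derivative g z + z * deriv g z) (at z)"
      using gd[OF zD] by (auto intro!: derivative_eq_intros)
    then have "(f has_field_derivative g z + z * deriv g z) (at z)"
      by (rule DERIV_cong_ev[THEN iffD1, rotated -1])
        (use zD fg in \<open>auto simp: unit_disk_def eventually_nhds intro!: exI[of _ "ball 0 1"]\<close>)
    then have "deriv f z = g z + z * deriv g z" by (rule DERIV_imp_deriv)
    then have "(z * (g z + z * deriv g z)) / (z * g z) = 1 + z * p1 z"
      using eq[OF zD] p1(2)[OF zD] z0 by (simp add: zfq_def fg[OF zD] diff_eq_eq add.commute)
    then have "g z + z * deriv g z = (1 + z * p1 z) * g z" using z0 by (simp add: divide_eq_eq)
    then show ?thesis using z0 by (simp add: algebra_simps)
  qed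
  \<comment> \<open>Both sides are holomorphic on the whole disk and agree on a nonempty open set,
    so the equation persists at the zeros of \<open>g\<close>.\<close>
  have ode: "deriv g z = p1 z * g z" if "z \<in> unit_disk" for z
  proof (rule analytic_continuation_open[of "V - {0}" unit_disk "deriv g" "\<lambda>z. p1 z * g z"])
    show "deriv g holomorphic_on unit_disk" by (rule holomorphic_deriv[OF gh D(1)])
    show "(\<lambda>z. p1 z * g z) holomorphic_on unit_disk" by (intro holomorphic_intros gh p1)
    show "open (V - {0})" using V by (rule open_delete)
    show "V - {0} \<subseteq> unit_disk" by (auto simp: V_def)
  qed (use D that Vne odeV in auto)
  \<comment> \<open>\<open>exp (- P)\<close> is an integrating factor: \<open>g * exp (- P)\<close>
    is constant and nonzero at 0, so \<open>g\<close> has no zeros.\<close>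
  obtain P where P: "\<And>z. z \<in> unit_disk \<Longrightarrow> (P has_field_derivative p1 z) (at z within unit_disk)"
    using holomorphic_convex_primitive'[OF D(2,1) p1(1)] by blast
  have "\<exists>c. \<forall>z\<in>unit_disk. g z * exp (- P z) = c"
  proof (rule has_field_derivative_zero_constant[OF D(2)])
    fix z assume z: "z \<in> unit_disk"
    show "((\<lambda>z. g z * exp (- P z)) has_field_derivative 0) (at z within unit_disk)"
      by (rule derivative_eq_intros refl has_field_derivative_at_within[OF gd[OF z]] P[OF z])+
        (simp add: ode[OF z] algebra_simps)
  qed
  then have "g z0 * exp (- P z0) = g 0 * exp (- P 0)" using z0 D(4) by metis
  then have "g z0 \<noteq> 0" using g0 by auto
  then show ?thesis using fg z0 by simp
qed

text \<open>The maximum modulus principle is applied to the cofactor \<open>K\<close>: on the circle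
  of radius \<open>r\<close> it is at most \<open>1 / r^n\<close>, hence also inside, and then
  \<open>r\<close> tends to 1.\<close>

lemma Schwarz_power:
  fixes \<omega> K :: "complex \<Rightarrow> complex"
  assumes K: "K holomorphic_on unit_disk" and eq: "\<And>z. z \<in> unit_disk \<Longrightarrow> \<omega> z = z ^ n * K z"
    and bd: "\<And>z. z \<in> unit_disk \<Longrightarrow> norm (\<omega> z) \<le> 1" and z: "z \<in> unit_disk"
  shows "norm (\<omega> z) \<le> norm z ^ n"
proof -
  have le: "norm (K z) * r ^ n \<le> 1" if r: "norm z < r" "r < 1" for r
  proof -
    have r0: "r > 0" using r norm_ge_zero[of z] by linarith
    have sub: "cball 0 r \<subseteq> unit_disk" using r by (auto simp: unit_disk_def)
    have "norm (K z) \<le> 1 / r ^ n"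
    proof (rule maximum_modulus_frontier[where S = "ball 0 r" and f = K])
      show "K holomorphic_on interior (ball 0 r)"
        using K sub by (meson holomorphic_on_subset interior_subset ball_subset_cball subset_trans)
      show "continuous_on (closure (ball 0 r)) K"
        using K sub r0 by (metis closure_ball continuous_on_subset holomorphic_on_imp_continuous_on)
      fix w :: complex assume "w \<in> frontier (ball 0 r)"
      then have w: "norm w = r" using r0 by (simp add: frontier_ball)
      then have "norm (\<omega> w) = r ^ n * norm (K w)" "norm (\<omega> w) \<le> 1"
        using eq[of w] bd[of w] r by (auto simp: unit_disk_def norm_mult norm_power)
      then show "norm (K w) \<le> 1 / r ^ n" using r0 by (simp add: field_simps)
    qed (use r in auto)
    then show ?thesis using r0 by (simp add: field_simps)
  qed
  have "norm (K z) * 1 ^ n \<le> 1"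
  proof (rule tendsto_upperbound)
    show "((\<lambda>r. norm (K z) * r ^ n) \<longlongrightarrow> norm (K z) * 1 ^ n) (at_left (1::real))"
      by (intro tendsto_intros)
    show "\<forall>\<^sub>F r in at_left 1. norm (K z) * r ^ n \<le> 1"
      using z le by (intro eventually_at_leftI[of "norm z"]) (auto simp: unit_disk_def)
  qed auto
  then show ?thesis
    using eq[OF z] by (simp add: norm_mult norm_power mult_left_le)
qed

lemma one_plus_mult_nonzero:
  assumes "\<bar>B\<bar> \<le> 1" "norm w < 1"
  shows "1 + complex_of_real B * w \<noteq> 0"
proof
  assume "1 + complex_of_real B * w = 0"
  then have "norm (complex_of_real B * w) = 1" by (metis add_eq_0_iff norm_minus_cancel norm_one)
  moreover have "norm (complex_of_real B * w) \<le> 1 * norm w"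
    unfolding norm_mult by (intro mult_right_mono) (use assms in auto)
  ultimately show False using assms by simp
qed

text \<open>Subordination alone gives only a zero of \<open>\<omega>\<close> at 0. Solving the
  Moebius relation for \<open>\<omega>\<close> transfers the factor \<open>z^n\<close> of
  \<open>zfq f - 1\<close> to \<open>\<omega>\<close>, which yields the power in the bound.\<close>

lemma class_S_AB_schwarz:
  assumes n: "n \<ge> 1" and AB: "-1 \<le> B" "B < A" "A \<le> 1" and f: "f \<in> class_S_AB n A B"
  obtains \<omega> where "\<omega> holomorphic_on unit_disk"
    "\<And>z. z \<in> unit_disk \<Longrightarrow> norm (\<omega> z) < 1"
    "\<And>z. z \<in> unit_disk \<Longrightarrow> norm (\<omega> z) \<le> norm z ^ n"
    "\<And>z. z \<in> unit_disk \<Longrightarrow> zfq f z = (1 + of_real A * \<omega> z) / (1 + of_real B * \<omega> z)"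
proof -
  obtain \<omega> where \<omega>: "\<omega> holomorphic_on unit_disk" "\<And>z. z \<in> unit_disk \<Longrightarrow> norm (\<omega> z) < 1"
    and eq: "\<And>z. z \<in> unit_disk \<Longrightarrow> zfq f z = (1 + of_real A * \<omega> z) / (1 + of_real B * \<omega> z)"
    and fA: "f \<in> class_A n"
    using f by (fastforce simp: class_S_AB_def subordinate_def unit_disk_def)
  have nz: "1 + of_real B * \<omega> z \<noteq> 0" if "z \<in> unit_disk" for z
    using one_plus_mult_nonzero[of B "\<omega> z"] \<omega>(2)[OF that] AB by auto
  define p where "p = (\<lambda>z. (1 + of_real A * \<omega> z) / (1 + of_real B * \<omega> z))"
  have p: "p holomorphic_on unit_disk"
    unfolding p_def by (intro holomorphic_intros \<omega>(1) nz)
  have "f z \<noteq> 0" if "z \<in> unit_disk" "z \<noteq> 0" for z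
    by (rule class_A_nonzero[OF n fA p _ that]) (simp add: eq p_def)
  then obtain K where K: "K holomorphic_on unit_disk"
    "\<And>z. z \<in> unit_disk \<Longrightarrow> zfq f z = 1 + z ^ n * K z"
    using zfq_factor[OF n fA] by blast
  have "\<omega> z = z ^ n * (K z * (1 + of_real B * \<omega> z) / of_real (A - B))" if z: "z \<in> unit_disk" for z
  proof -
    have "1 + of_real A * \<omega> z = (1 + z ^ n * K z) * (1 + of_real B * \<omega> z)"
      using eq[OF z] K(2)[OF z] nz[OF z] by (simp add: field_simps)
    then have "of_real (A - B) * \<omega> z = z ^ n * K z * (1 + of_real B * \<omega> z)"
      by (simp add: algebra_simps)
    moreover have "complex_of_real (A - B) \<noteq> 0" using AB by simp
    ultimately show ?thesis by (simp add: field_simps del: of_real_diff)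
  qed
  moreover have "(\<lambda>z. K z * (1 + of_real B * \<omega> z) / of_real (A - B)) holomorphic_on unit_disk"
    by (intro holomorphic_intros K \<omega>) (use AB in auto)
  ultimately have "norm (\<omega> z) \<le> norm z ^ n" if "z \<in> unit_disk" for z
    using Schwarz_power[of _ \<omega> n z] \<omega>(2) that less_imp_le by blast
  then show ?thesis using that \<omega> eq by blast
qed

section \<open>Radii\<close>

lemma mult_in_unit_disk: "0 < r \<Longrightarrow> r \<le> 1 \<Longrightarrow> z \<in> unit_disk \<Longrightarrow> of_real r * z \<in> unit_disk"
  using mult_left_le_one_le[of "norm z" r] by (auto simp: unit_disk_def norm_mult)

lemma dilate_class_A:
  assumes "n \<ge> 1" "f \<in> class_A n" "0 < r" "r \<le> 1"
  shows "dilate r f \<in> class_A n"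
proof -
  obtain G where G: "G holomorphic_on unit_disk"
    "\<And>z. z \<in> unit_disk \<Longrightarrow> f z = z + z ^ Suc n * G z"
    using assms(2) class_A_iff[OF assms(1)] by auto
  have "(\<lambda>z. of_real (r ^ n) * G (of_real r * z)) holomorphic_on unit_disk"
    by (intro holomorphic_intros holomorphic_on_compose_gen[OF _ G(1), unfolded o_def])
      (use mult_in_unit_disk assms in auto)
  moreover have "dilate r f z = z + z ^ Suc n * (of_real (r ^ n) * G (of_real r * z))"
    if "z \<in> unit_disk" for z
    using G(2)[OF mult_in_unit_disk[OF assms(3,4) that]] assms(3)
    by (simp add: dilate_def field_simps power_mult_distrib)
  ultimately show ?thesis using class_A_iff[OF assms(1)] by blast
qed

lemma zfq_dilate:
  assumes "f holomorphic_on unit_disk" "0 < r" "r \<le> 1" "z \<in> unit_disk"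
  shows "zfq (dilate r f) z = zfq f (of_real r * z)"
proof -
  have "(f has_field_derivative deriv f (of_real r * z)) (at (of_real r * z))"
    by (rule holomorphic_derivI[OF assms(1) _ mult_in_unit_disk[OF assms(2-4)]])
      (simp add: unit_disk_def)
  then have "((\<lambda>z. f (of_real r * z)) has_field_derivative
      deriv f (of_real r * z) * of_real r) (at z)"
    by (rule DERIV_chain2) (auto intro!: derivative_eq_intros)
  then have "(dilate r f has_field_derivative deriv f (of_real r * z) * of_real r / of_real r) (at z)"
    unfolding dilate_def by (rule DERIV_cdivide)
  then have "deriv (dilate r f) z = deriv f (of_real r * z)"
    using assms(2) by (simp add: DERIV_imp_deriv)
  then show ?thesis using assms(2) by (simp add: zfq_def dilate_def)
qed

text \<open>By univalence \<open>z * exp z\<close> has a holomorphic inverse \<open>k\<close> on its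
  image, and the image contains the shifted ball; so \<open>k (g z - 1)\<close> is the required
  Schwarz function.\<close>

lemma subordinate_wpI:
  assumes g: "g holomorphic_on unit_disk" and g0: "g 0 = 1"
    and ball: "\<And>z. z \<in> unit_disk \<Longrightarrow> g z \<in> ball (of_real (1 + sinh 1)) (cosh 1)"
    and eq: "\<And>z. z \<in> unit_disk \<Longrightarrow> p z = g z"
  shows "subordinate p wp"
proof -
  let ?h = "\<lambda>z::complex. z * exp z"
  have "?h holomorphic_on unit_disk" "open unit_disk" "inj_on ?h unit_disk"
    using inj_on_z_exp by (auto simp: unit_disk_def intro: holomorphic_intros)
  then have "\<exists>k. k holomorphic_on (?h ` unit_disk) \<and> (\<forall>z\<in>unit_disk. k (?h z) = z)"
    by (rule holomorphic_has_inverse) (intro exI conjI ballI; assumption)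
  then obtain k where k: "k holomorphic_on (?h ` unit_disk)" "\<And>z. z \<in> unit_disk \<Longrightarrow> k (?h z) = z"
    by auto
  have range: "g z - 1 \<in> ?h ` unit_disk" if "z \<in> unit_disk" for z
  proof -
    have "g z - 1 \<in> ball (of_real (sinh 1)) (cosh 1)"
      using ball[OF that] by (simp add: dist_norm algebra_simps)
    then show ?thesis using ball_subset_z_exp_image by (auto simp: unit_disk_def)
  qed
  define \<omega> where "\<omega> = (\<lambda>z. k (g z - 1))"
  have "\<omega> holomorphic_on unit_disk"
    unfolding \<omega>_def
    by (rule holomorphic_on_compose_gen[OF _ k(1), unfolded o_def])
      (use range g in \<open>auto intro!: holomorphic_intros\<close>)
  moreover have \<omega>: "\<omega> z \<in> unit_disk \<and> ?h (\<omega> z) = g z - 1" if "z \<in> unit_disk" for z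
    using range[OF that] k(2) by (auto simp: \<omega>_def)
  moreover have "\<omega> 0 = 0"
    using k(2)[of 0] g0 by (simp add: \<omega>_def unit_disk_def)
  ultimately show ?thesis
    unfolding subordinate_def wp_def using eq by (intro exI[of _ \<omega>]) auto
qed

lemma diff_scaled_pos:
  fixes A B k :: real
  assumes "B < A" "0 \<le> A" "0 < k" "k \<le> 1"
  shows "0 < A - k * B"
proof (cases "0 \<le> B")
  case True
  then have "k * B \<le> 1 * B" using assms by (intro mult_right_mono) auto
  then show ?thesis using assms by simp
next
  case False
  then have "k * B < 0" using assms by (simp add: mult_less_0_iff)
  then show ?thesis using assms by simp
qed

text \<open>Membership of \<open>(1 + A w) / (1 + B w)\<close> in the disk with diameter \<open>(1 - 1/e, 1 + e)\<close> says
  that a function of \<open>Re w\<close> and \<open>\<bar>w\<bar>\<close> is negative. For fixed \<open>\<bar>w\<bar>\<close> it is affine in \<open>Re w\<close>,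
  so only real \<open>w\<close> matter.\<close>

lemma moebius_in_ball:
  fixes A B x :: real and w :: complex
  assumes AB: "-1 \<le> B" "B < A" "0 \<le> A" "A \<le> 1" and x: "0 < x" "x \<le> 1"
    and left: "x * (A - (1 - exp (-1)) * B) \<le> exp (-1)"
    and right: "x * (A - (exp 1 + 1) * B) \<le> exp 1"
    and w: "norm w < x"
  shows "(1 + of_real A * w) / (1 + of_real B * w) \<in> ball (of_real (1 + sinh 1)) (cosh 1)"
proof -
  define \<alpha> \<gamma> :: real where "\<alpha> = exp (-1)" and "\<gamma> = exp 1"
  \<comment> \<open>For \<open>p = (1 + A w) / (1 + B w)\<close> the differences to the ends of the
    diameter are \<open>p - (1 - \<alpha>) = (\<alpha> + \<beta> w) / (1 + B w)\<close> and
    \<open>(1 + \<gamma>) - p = (\<gamma> - \<delta> w) / (1 + B w)\<close>.\<close>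
  define \<beta> \<delta> where "\<beta> = A - (1 - \<alpha>) * B" and "\<delta> = A - (1 + \<gamma>) * B"
  define t u where "t = norm w" and "u = Re w"
  have pos: "0 < \<alpha>" "0 < \<gamma>" "\<alpha> < 1" by (auto simp: \<alpha>_def \<gamma>_def)
  have t: "0 \<le> t" "t < x" "t < 1" "\<bar>u\<bar> \<le> t"
    using w x abs_Re_le_cmod[of w] by (auto simp: t_def u_def)
  have \<beta>: "0 < \<beta>"
    unfolding \<beta>_def using diff_scaled_pos[of B A "1 - \<alpha>"] AB pos by simp
  have ends: "0 < \<alpha> + \<beta> * t" "0 < \<alpha> - \<beta> * t" "0 < \<gamma> + \<delta> * t" "0 < \<gamma> - \<delta> * t"
  proof -
    show "0 < \<alpha> + \<beta> * t" using pos \<beta> t by (simp add: add_pos_nonneg)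
    have "\<beta> * t < \<beta> * x" using \<beta> t by simp
    then show "0 < \<alpha> - \<beta> * t" using left by (simp add: \<alpha>_def \<beta>_def mult.commute)
    have "B * t < 1"
    proof -
      have "B * t \<le> 1 * t" using AB t by (intro mult_right_mono) auto
      then show ?thesis using t by simp
    qed
    then have "0 < \<gamma> * (1 - B * t)" using pos by simp
    moreover have "- \<gamma> * B * t \<le> \<delta> * t"
      using t AB by (intro mult_right_mono) (auto simp: \<delta>_def algebra_simps)
    ultimately show "0 < \<gamma> + \<delta> * t" by (simp add: algebra_simps)
    show "0 < \<gamma> - \<delta> * t"
    proof (cases "\<delta> \<le> 0")
      case True
      then have "\<delta> * t \<le> 0" using t by (simp add: mult_nonpos_nonneg)
      then show ?thesis using pos by linarith
    next
      case False
      then have "\<delta> * t < \<delta> * x" using t by simp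
      then show ?thesis using right by (simp add: \<gamma>_def \<delta>_def mult.commute add.commute)
    qed
  qed
  \<comment> \<open>Minus the real part of \<open>\<alpha> + \<beta> w\<close> times the conjugate
    of \<open>\<gamma> - \<delta> w\<close>. By Thales, its negativity places \<open>p\<close>
    inside the circle on that diameter.\<close>
  define F where "F = (\<lambda>u. - \<alpha> * \<gamma> + (\<alpha> * \<delta> - \<beta> * \<gamma>) * u + \<beta> * \<delta> * t\<^sup>2)"
  have "F u < 0"
  proof (cases "t = 0")
    case True
    then show ?thesis using t pos by (simp add: F_def)
  next
    case False
    have "F t = - ((\<alpha> + \<beta> * t) * (\<gamma> - \<delta> * t))" "F (-t) = - ((\<alpha> - \<beta> * t) * (\<gamma> + \<delta> * t))"
      by (simp_all add: F_def power2_eq_square algebra_simps)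
    then have "F t < 0" "F (-t) < 0" using ends by (simp_all del: minus_mult_minus)
    \<comment> \<open>Interpolation of the affine \<open>F\<close> between \<open>-t\<close> and
      \<open>t\<close>, multiplied by \<open>2 * t\<close>.\<close>
    moreover have "2 * t * F u = (t + u) * F t + (t - u) * F (-t)"
      by (simp add: F_def power2_eq_square algebra_simps)
    moreover have "(t + u) * F t \<le> 0" "(t - u) * F (-t) \<le> 0"
      using t calculation by (simp_all add: mult_nonneg_nonpos)
    moreover have "t + u > 0 \<or> t - u > 0" using t False by linarith
    ultimately have "2 * t * F u < 0"
      by (smt (verit) mult_pos_neg)
    then show ?thesis using t by (simp add: mult_less_0_iff)
  qed
  moreover have "F u = (norm (1 + of_real A * w - of_real (1 + sinh 1) * (1 + of_real B * w)))\<^sup>2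
      - (cosh 1)\<^sup>2 * (norm (1 + of_real B * w))\<^sup>2"
  proof -
    have m: "sinh 1 = (\<gamma> - \<alpha>) / 2" "cosh 1 = (\<gamma> + \<alpha>) / 2"
      by (simp_all add: sinh_field_def cosh_field_def \<gamma>_def \<alpha>_def)
    have t2: "t\<^sup>2 = u\<^sup>2 + (Im w)\<^sup>2" by (simp add: t_def u_def cmod_power2)
    show ?thesis
      unfolding m F_def t2 cmod_power2 \<beta>_def \<delta>_def u_def
      by (simp add: power2_eq_square field_simps)
  qed
  ultimately have "(norm (1 + of_real A * w - of_real (1 + sinh 1) * (1 + of_real B * w)))\<^sup>2
      < (cosh 1 * norm (1 + of_real B * w))\<^sup>2"
    by (simp add: power_mult_distrib)
  then have lt: "norm (1 + of_real A * w - of_real (1 + sinh 1) * (1 + of_real B * w))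
      < cosh 1 * norm (1 + of_real B * w)"
    by (rule power_less_imp_less_base) simp
  have nz: "1 + of_real B * w \<noteq> 0"
    using one_plus_mult_nonzero[of B w] AB t by (auto simp: t_def)
  have "(1 + of_real A * w) / (1 + of_real B * w) - of_real (1 + sinh 1)
      = (1 + of_real A * w - of_real (1 + sinh 1) * (1 + of_real B * w)) / (1 + of_real B * w)"
    using nz by (simp add: diff_divide_distrib)
  then have "norm ((1 + of_real A * w) / (1 + of_real B * w) - of_real (1 + sinh 1)) < cosh 1"
    using lt nz by (simp add: norm_divide divide_less_eq)
  then show ?thesis by (simp add: dist_norm norm_minus_commute)
qed

text \<open>The function is \<open>z (1 + B z^n)^((A - B) / (n B))\<close>, or
  \<open>z exp (A z^n / n)\<close> if \<open>B = 0\<close>. The primitive \<open>L\<close> covers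
  both cases without a choice of branch; the \<open>n\<close> in the denominator of \<open>l\<close>
  cancels the one from differentiating \<open>z^n\<close>.\<close>

lemma class_S_AB_extremal:
  assumes n: "n \<ge> 1" and AB: "-1 \<le> B" "B < A" "A \<le> 1"
  obtains f where "f \<in> class_S_AB n A B"
    "\<And>z. z \<in> unit_disk \<Longrightarrow> zfq f z = (1 + of_real A * z ^ n) / (1 + of_real B * z ^ n)"
proof -
  have D: "open unit_disk" "convex unit_disk" "0 \<in> unit_disk" by (auto simp: unit_disk_def)
  have pw: "z ^ n \<in> unit_disk" if "z \<in> unit_disk" for z
    using that n by (auto simp: unit_disk_def norm_power power_less_one_iff)
  have nz: "1 + of_real B * z \<noteq> 0" if "z \<in> unit_disk" for z
    using one_plus_mult_nonzero[of B z] AB that by (auto simp: unit_disk_def)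
  define l :: "complex \<Rightarrow> complex" where "l = (\<lambda>z. of_real (A - B) / (of_nat n * (1 + of_real B * z)))"
  have "l holomorphic_on unit_disk"
    unfolding l_def by (intro holomorphic_intros) (use nz n in auto)
  then obtain L0 where L0: "\<And>z. z \<in> unit_disk \<Longrightarrow> (L0 has_field_derivative l z) (at z within unit_disk)"
    using holomorphic_convex_primitive'[OF D(2,1)] by blast
  define L where "L = (\<lambda>z. L0 z - L0 0)"
  have L: "(L has_field_derivative l z) (at z)" if "z \<in> unit_disk" for z
    using L0[OF that] at_within_open[OF that D(1)] by (auto simp: L_def intro!: derivative_eq_intros)
  have Lh: "L holomorphic_on unit_disk"
    using L D(1) by (auto simp: holomorphic_on_open)
  have "(\<lambda>z. exp (L z) - 1) holomorphic_on unit_disk" by (intro holomorphic_intros Lh)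
  moreover have "exp (L 0) - 1 = 0" by (simp add: L_def)
  ultimately obtain N where N: "N holomorphic_on unit_disk"
    "\<And>z. z \<in> unit_disk \<Longrightarrow> exp (L z) - 1 = z * N z"
    by (rule holomorphic_factor_zero) blast
  define f where "f = (\<lambda>z. z * exp (L (z ^ n)))"
  have "(\<lambda>z. N (z ^ n)) holomorphic_on unit_disk"
    by (rule holomorphic_on_compose_gen[OF _ N(1), unfolded o_def])
      (use pw in \<open>auto intro!: holomorphic_intros\<close>)
  moreover have "f z = z + z ^ Suc n * N (z ^ n)" if "z \<in> unit_disk" for z
    using N(2)[OF pw[OF that]] by (simp add: f_def algebra_simps)
  ultimately have fA: "f \<in> class_A n" using class_A_iff[OF n] by blast
  have eq: "zfq f z = (1 + of_real A * z ^ n) / (1 + of_real B * z ^ n)" if z: "z \<in> unit_disk" for z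
  proof (cases "z = 0")
    case True
    then show ?thesis using n by (simp add: zfq_def power_0_left)
  next
    case False
    obtain m where m: "n = Suc m" using n by (cases n) auto
    have "((\<lambda>z. z ^ n) has_field_derivative of_nat n * z ^ m) (at z)"
      using DERIV_power_Suc[OF DERIV_ident, where n = m and x = z and s = UNIV] by (simp add: m)
    then have "((\<lambda>z. L (z ^ n)) has_field_derivative l (z ^ n) * (of_nat n * z ^ m)) (at z)"
      by (rule DERIV_chain2[where f = L and g = "\<lambda>z. z ^ n", OF L[OF pw[OF z]]])
    then have "(f has_field_derivative
        exp (L (z ^ n)) * (1 + z * (l (z ^ n) * (of_nat n * z ^ m)))) (at z)"
      unfolding f_def by (auto intro!: derivative_eq_intros simp: algebra_simps)
    then have "deriv f z = exp (L (z ^ n)) * (1 + z * (l (z ^ n) * (of_nat n * z ^ m)))"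
      by (rule DERIV_imp_deriv)
    then have "zfq f z = 1 + z * (l (z ^ n) * (of_nat n * z ^ m))"
      using False by (simp add: zfq_def f_def)
    also have "\<dots> = 1 + of_real (A - B) * z ^ n / (1 + of_real B * z ^ n)"
    proof -
      have "complex_of_nat n \<noteq> 0" using n by simp
      then have "l (z ^ n) * of_nat n = of_real (A - B) / (1 + of_real B * z ^ n)"
        by (simp add: l_def)
      then have "z * (l (z ^ n) * (of_nat n * z ^ m)) = of_real (A - B) / (1 + of_real B * z ^ n) * z ^ n"
        by (metis (no_types) m mult.assoc mult.left_commute power_Suc)
      then show ?thesis by simp
    qed
    also have "\<dots> = (1 + of_real A * z ^ n) / (1 + of_real B * z ^ n)"
      using nz[OF pw[OF z]] by (simp add: field_simps)
    finally show ?thesis .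
  qed
  have "f \<in> class_S_AB n A B"
    unfolding class_S_AB_def subordinate_def
    using fA eq pw n by (auto intro!: exI[of _ "\<lambda>z. z ^ n"] holomorphic_intros)
  then show ?thesis using that eq by blast
qed

lemma class_S_wp_real_value:
  assumes "f \<in> class_S_wp n" "z \<in> unit_disk" "zfq f z = of_real v"
  shows "1 - exp (-1) < v" "v < 1 + exp 1"
proof -
  obtain \<omega> where "\<omega> ` unit_disk \<subseteq> unit_disk" "\<forall>z\<in>unit_disk. zfq f z = wp (\<omega> z)"
    using assms(1) by (auto simp: class_S_wp_def subordinate_def)
  then obtain w where "w \<in> ball 0 1" "zfq f z = wp w"
    using assms(2) unfolding unit_disk_def by blast
  then have "w \<in> ball 0 1" "w * exp w = of_real (v - 1)"
    using assms(3) by (auto simp: wp_def)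
  from z_exp_real_bounds[OF this] show "1 - exp (-1) < v" "v < 1 + exp 1" by auto
qed

text \<open>Cleared of denominators, \<open>left\<close> and \<open>right\<close> bound the Moebius
  map at \<open>-(R^n)\<close> and \<open>R^n\<close>. Equality is harmless for membership, since
  \<open>norm z < 1\<close> keeps \<open>\<omega>\<close> strictly below \<open>R^n\<close>; beyond
  \<open>R\<close>, the extremal function violates the bound that is attained.\<close>

lemma is_radius_class_S_AB:
  fixes A B R :: real
  assumes n: "n \<ge> 1" and AB: "-1 \<le> B" "B < A" "0 \<le> A" "A \<le> 1" and R: "0 < R" "R \<le> 1"
    and left: "R ^ n * (A - (1 - exp (-1)) * B) \<le> exp (-1)"
    and right: "R ^ n * (A - (exp 1 + 1) * B) \<le> exp 1"
    and sharp: "R = 1 \<or> R ^ n * (A - (1 - exp (-1)) * B) = exp (-1)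
      \<or> R ^ n * (A - (exp 1 + 1) * B) = exp 1"
  shows "is_radius (class_S_wp n) (class_S_AB n A B) R"
  unfolding is_radius_def
proof (intro conjI allI impI)
  show "radius_ok (class_S_wp n) (class_S_AB n A B) R"
    unfolding radius_ok_def
  proof (intro allI impI ballI, elim conjE)
    fix r f assume r: "0 < r" "r \<le> R" and f: "f \<in> class_S_AB n A B"
    have r1: "r \<le> 1" using r R by simp
    have fA: "f \<in> class_A n" using f by (simp add: class_S_AB_def)
    obtain \<omega> where \<omega>: "\<omega> holomorphic_on unit_disk"
      "\<And>z. z \<in> unit_disk \<Longrightarrow> norm (\<omega> z) < 1"
      "\<And>z. z \<in> unit_disk \<Longrightarrow> norm (\<omega> z) \<le> norm z ^ n"
      "\<And>z. z \<in> unit_disk \<Longrightarrow> zfq f z = (1 + of_real A * \<omega> z) / (1 + of_real B * \<omega> z)"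
      using class_S_AB_schwarz[OF n AB(1,2,4) f] by blast
    have disk: "of_real r * z \<in> unit_disk" if "z \<in> unit_disk" for z
      using mult_in_unit_disk[OF r(1) r1 that] .
    define g where "g = (\<lambda>z. (1 + of_real A * \<omega> (of_real r * z)) / (1 + of_real B * \<omega> (of_real r * z)))"
    have g: "zfq f (of_real r * z) = g z" if "z \<in> unit_disk" for z
      using \<omega>(4)[OF disk[OF that]] by (simp add: g_def)
    have "subordinate (zfq (dilate r f)) wp"
    proof (rule subordinate_wpI)
      have "(\<lambda>z. \<omega> (of_real r * z)) holomorphic_on unit_disk"
        by (rule holomorphic_on_compose_gen[OF _ \<omega>(1), unfolded o_def])
          (use disk in \<open>auto intro!: holomorphic_intros\<close>)
      then show "g holomorphic_on unit_disk"
        unfolding g_def using one_plus_mult_nonzero[of B] \<omega>(2)[OF disk] AB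
        by (auto intro!: holomorphic_intros)
      show "g 0 = 1" using g[of 0] by (simp add: unit_disk_def zfq_def)
      show "zfq (dilate r f) z = g z" if "z \<in> unit_disk" for z
        using zfq_dilate[OF class_A_holomorphic[OF fA] r(1) r1 that] g[OF that] by simp
      show "g z \<in> ball (of_real (1 + sinh 1)) (cosh 1)" if z: "z \<in> unit_disk" for z
        unfolding g_def
      proof (rule moebius_in_ball[OF AB _ _ left right])
        have "norm (\<omega> (of_real r * z)) \<le> (r * norm z) ^ n"
          using \<omega>(3)[OF disk[OF z]] r by (simp add: norm_mult)
        also have "\<dots> < R ^ n"
        proof (rule power_strict_mono)
          have "r * norm z < r * 1" using z r by (auto simp: unit_disk_def)
          then show "r * norm z < R" using r by linarith
        qed (use n r in auto)
        finally show "norm (\<omega> (of_real r * z)) < R ^ n" .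
      qed (use R in \<open>auto simp: power_le_one\<close>)
    qed
    then show "dilate r f \<in> class_S_wp n"
      using dilate_class_A[OF n fA r(1) r1] by (simp add: class_S_wp_def)
  qed
next
  fix R' assume "R < R' \<and> R' \<le> 1"
  then have R': "R < R'" "R' \<le> 1" by auto
  show "\<not> radius_ok (class_S_wp n) (class_S_AB n A B) R'"
  proof
    assume ok: "radius_ok (class_S_wp n) (class_S_AB n A B) R'"
    obtain f where f: "f \<in> class_S_AB n A B"
      "\<And>z. z \<in> unit_disk \<Longrightarrow> zfq f z = (1 + of_real A * z ^ n) / (1 + of_real B * z ^ n)"
      using class_S_AB_extremal[OF n AB(1,2,4)] by blast
    have wp: "dilate R' f \<in> class_S_wp n" using ok f(1) R R' by (auto simp: radius_ok_def)
    \<comment> \<open>Below \<open>R'\<close>, so that radius \<open>t\<close> is reached inside the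
      open disk after dilation; above \<open>R\<close>, so that the attained bound fails.\<close>
    obtain t where t: "R < t" "t < R'" using dense R' by blast
    have tn: "R ^ n < t ^ n" "t ^ n < 1"
      using t R R' n by (auto intro!: power_strict_mono simp: power_less_one_iff)
    have Bt: "\<bar>B * t ^ n\<bar> < 1"
    proof -
      have "\<bar>B\<bar> * t ^ n \<le> 1 * t ^ n" using AB t R by (intro mult_right_mono) auto
      moreover have "\<bar>B * t ^ n\<bar> = \<bar>B\<bar> * t ^ n" using t R by (simp add: abs_mult)
      ultimately show ?thesis using tn by linarith
    qed
    have value_at: "1 - exp (-1) < (1 + A * (s * t ^ n)) / (1 + B * (s * t ^ n))"
      "(1 + A * (s * t ^ n)) / (1 + B * (s * t ^ n)) < 1 + exp 1"
      if \<zeta>: "norm \<zeta> = 1" "\<zeta> ^ n = of_real s" for \<zeta> :: complex and s :: real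
    proof -
      define z where "z = of_real (t / R') * \<zeta>"
      have z: "z \<in> unit_disk" using \<zeta> t R R' by (simp add: z_def unit_disk_def norm_mult norm_divide)
      have tz: "of_real R' * z = of_real t * \<zeta>" using R R' by (simp add: z_def)
      have "of_real t * \<zeta> \<in> unit_disk"
        using \<zeta> t R R' by (simp add: unit_disk_def norm_mult)
      then have "zfq (dilate R' f) z = (1 + of_real A * (of_real t * \<zeta>) ^ n) / (1 + of_real B * (of_real t * \<zeta>) ^ n)"
        using zfq_dilate[of f R' z] f R R' z by (simp add: class_S_AB_def class_A_def tz)
      also have "\<dots> = of_real ((1 + A * (s * t ^ n)) / (1 + B * (s * t ^ n)))"
        by (simp add: power_mult_distrib \<zeta> mult.commute)
      finally show "1 - exp (-1) < (1 + A * (s * t ^ n)) / (1 + B * (s * t ^ n))"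
        "(1 + A * (s * t ^ n)) / (1 + B * (s * t ^ n)) < 1 + exp 1"
        using class_S_wp_real_value[OF wp z] by blast+
    qed
    consider "R ^ n * (A - (1 - exp (-1)) * B) = exp (-1)" | "R ^ n * (A - (exp 1 + 1) * B) = exp 1"
      using sharp R' by auto
    then show False
    proof cases
      case 1
      \<comment> \<open>The direction \<open>cis (pi / n)\<close> has \<open>n\<close>-th power -1
        and so yields the left end point; the direction 1 yields the right one.\<close>
      have "real n * (pi / real n) = pi" using n by simp
      then have "cis (pi / real n) ^ n = of_real (-1)" by (simp only: Complex.DeMoivre cis_pi of_real_minus of_real_1)
      then have "1 - exp (-1) < (1 + A * (-1 * t ^ n)) / (1 + B * (-1 * t ^ n))"
        by (intro value_at(1)) auto
      then have "(1 - exp (-1)) * (1 - B * t ^ n) < 1 - A * t ^ n"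
        using Bt by (simp add: less_divide_eq split: if_splits)
      then have "t ^ n * (A - (1 - exp (-1)) * B) < exp (-1)" by (simp add: algebra_simps)
      moreover have "0 < A - (1 - exp (-1)) * B"
        using 1 R by (metis exp_gt_zero zero_less_mult_pos zero_less_power)
      ultimately show False using 1 tn(1) by (smt (verit) mult_right_mono)
    next
      case 2
      have "(1 + A * (1 * t ^ n)) / (1 + B * (1 * t ^ n)) < 1 + exp 1"
        by (intro value_at(2)[of 1]) auto
      then have "1 + A * t ^ n < (1 + exp 1) * (1 + B * t ^ n)"
        using Bt by (simp add: divide_less_eq split: if_splits)
      then have "t ^ n * (A - (exp 1 + 1) * B) < exp 1" by (simp add: algebra_simps)
      moreover have "0 < A - (exp 1 + 1) * B"
        using 2 R by (metis exp_gt_zero zero_less_mult_pos zero_less_power)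
      ultimately show False using 2 tn(1) by (smt (verit) mult_right_mono)
    qed
  qed
qed (use R in auto)

text \<open>The Cayley transform \<open>(p - 1) / (p + 1)\<close> maps the right half plane onto the
  disk; its inverse is the Moebius map with \<open>A = 1\<close>, \<open>B = -1\<close>.\<close>

lemma class_Sstar_eq: "class_Sstar = class_S_AB 1 1 (-1)"
proof (intro equalityI subsetI)
  fix f assume f: "f \<in> class_Sstar"
  then have fA: "f \<in> class_A 1" and Re: "\<And>z. z \<in> unit_disk \<Longrightarrow> Re (zfq f z) > 0"
    by (auto simp: class_Sstar_def)
  \<comment> \<open>At a zero of \<open>f\<close>, division by zero gives
    \<open>zfq f z = 0\<close>, against the positive real part.\<close>
  have "f z \<noteq> 0" if "z \<in> unit_disk" "z \<noteq> 0" for z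
    using Re[OF that(1)] that(2) by (auto simp: zfq_def)
  then obtain K where K: "K holomorphic_on unit_disk"
    "\<And>z. z \<in> unit_disk \<Longrightarrow> zfq f z = 1 + z ^ 1 * K z"
    using zfq_factor[of 1 f, OF _ fA] by auto
  define p where "p = (\<lambda>z. 1 + z * K z)"
  have pq: "zfq f z = p z" if "z \<in> unit_disk" for z using K(2)[OF that] by (simp add: p_def)
  have p: "p holomorphic_on unit_disk" unfolding p_def by (intro holomorphic_intros K)
  have p1: "norm (p z - 1) < norm (p z + 1)" "p z + 1 \<noteq> 0" if "z \<in> unit_disk" for z
  proof -
    have pos: "Re (p z) > 0" using Re[OF that] pq[OF that] by simp
    then have "(norm (p z - 1))\<^sup>2 < (norm (p z + 1))\<^sup>2"
      unfolding cmod_power2 by (simp add: power2_eq_square algebra_simps)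
    then show "norm (p z - 1) < norm (p z + 1)" by (rule power_less_imp_less_base) simp
    then show "p z + 1 \<noteq> 0" by auto
  qed
  define \<omega> where "\<omega> = (\<lambda>z. (p z - 1) / (p z + 1))"
  have "\<omega> holomorphic_on unit_disk" unfolding \<omega>_def by (intro holomorphic_intros p p1)
  moreover have "\<omega> ` unit_disk \<subseteq> unit_disk"
    using p1 by (auto simp: \<omega>_def unit_disk_def norm_divide divide_less_eq)
  moreover have "\<omega> 0 = 0" by (simp add: \<omega>_def p_def)
  moreover have "zfq f z = (1 + of_real 1 * \<omega> z) / (1 + of_real (-1) * \<omega> z)" if "z \<in> unit_disk" for z
  proof -
    have "1 + \<omega> z = 2 * p z / (p z + 1)" "1 - \<omega> z = 2 / (p z + 1)"
      using p1(2)[OF that] by (simp_all add: \<omega>_def field_simps)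
    then show ?thesis using p1(2)[OF that] pq[OF that] by simp
  qed
  ultimately show "f \<in> class_S_AB 1 1 (-1)"
    unfolding class_S_AB_def subordinate_def using fA by blast
next
  fix f assume f: "f \<in> class_S_AB 1 1 (-1)"
  then obtain \<omega> where "\<omega> ` unit_disk \<subseteq> unit_disk"
    and \<omega>: "\<forall>z\<in>unit_disk. zfq f z = (1 + of_real 1 * \<omega> z) / (1 + of_real (-1) * \<omega> z)"
    unfolding class_S_AB_def subordinate_def by blast
  then have \<omega>1: "norm (\<omega> z) < 1" if "z \<in> unit_disk" for z
    using that by (auto simp: unit_disk_def image_subset_iff)
  have "Re (zfq f z) > 0" if "z \<in> unit_disk" for z
  proof -
    have "(norm (\<omega> z))\<^sup>2 < 1" using \<omega>1[OF that] by (simp add: abs_square_less_1)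
    moreover have "1 - \<omega> z \<noteq> 0" using \<omega>1[OF that] by auto
    moreover have "Re ((1 + \<omega> z) / (1 - \<omega> z)) = (1 - (norm (\<omega> z))\<^sup>2) / (norm (1 - \<omega> z))\<^sup>2"
      unfolding Re_divide cmod_power2 by (simp add: power2_eq_square algebra_simps)
    ultimately show ?thesis using \<omega> that by simp
  qed
  then show "f \<in> class_Sstar" using f by (simp add: class_Sstar_def class_S_AB_def)
qed

section \<open>The radii in closed form\<close>

lemma min_powr_power:
  fixes x :: real
  assumes "0 < x" "n \<ge> 1"
  shows "(min 1 (x powr (1 / real n))) ^ n = min 1 x"
proof -
  have "(x powr (1 / real n)) ^ n = x" using assms by (simp add: powr_power)
  moreover have "x powr (1 / real n) \<le> 1 \<longleftrightarrow> (x powr (1 / real n)) ^ n \<le> 1"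
    using assms by (simp add: power_le_one_iff)
  ultimately show ?thesis by (auto simp: min_def)
qed

text \<open>\<open>R1\<close> meets the left bound by construction and, for \<open>B < 0\<close>,
  \<open>R2\<close> meets the right one, with equality unless the radius is 1. Only the opposite
  bound needs an argument.\<close>

lemma is_radius_class_S_AB_cases:
  fixes n :: nat and A B :: real
  assumes n: "n \<ge> 1" and AB: "-1 \<le> B" "B < A" "0 \<le> A" "A \<le> 1"
  defines "R1 \<equiv> min 1 (((1 / exp 1) / (A - (1 - 1 / exp 1) * B)) powr (1 / real n))"
      and "R2 \<equiv> min 1 ((exp 1 / (A - (exp 1 + 1) * B)) powr (1 / real n))"
      and "r1 \<equiv> (((exp 1 ^ 2 - 1) / (2 * exp 1)) /
                 (((exp 1 ^ 2 + 2 * exp 1 - 1) / (2 * exp 1)) * B ^ 2 - A * B)) powr (1 / (2 * real n))"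
  shows "is_radius (class_S_wp n) (class_S_AB n A B) (if 0 \<le> B \<or> R1 \<le> r1 then R1 else R2)"
proof -
  define e :: real where "e = exp 1"
  have e1: "e > 1" and em: "exp (-1) = 1 / e" by (simp_all add: e_def exp_minus inverse_eq_divide)
  define \<beta> \<delta> where "\<beta> = A - (1 - 1 / e) * B" and "\<delta> = A - (e + 1) * B"
  have ie: "0 < 1 / e" "1 / e < 1" using e1 by auto
  have \<beta>: "0 < \<beta>"
    unfolding \<beta>_def using diff_scaled_pos[of B A "1 - 1 / e"] AB ie by simp
  define x where "x = R1 ^ n"
  have R1: "0 < R1" "R1 \<le> 1" "x = min 1 ((1 / e) / \<beta>)"
    using \<beta> e1 n by (auto simp: R1_def x_def e_def \<beta>_def min_powr_power)
  have x: "0 < x" "x \<le> 1" "x * \<beta> \<le> 1 / e" "R1 = 1 \<or> x * \<beta> = 1 / e"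
  proof -
    show "0 < x" "x \<le> 1" using R1 \<beta> e1 by auto
    have "x \<le> (1 / e) / \<beta>" using R1(3) by simp
    then show "x * \<beta> \<le> 1 / e" using \<beta> by (simp only: le_divide_eq if_True)
    have "x = 1 \<longrightarrow> R1 = 1"
      using R1 n power_eq_1_iff[of R1 n] by (auto simp: x_def)
    then show "R1 = 1 \<or> x * \<beta> = 1 / e" using R1(3) \<beta> by (auto simp: min_def split: if_splits)
  qed
  have radius1: "is_radius (class_S_wp n) (class_S_AB n A B) R1" if "x * \<delta> \<le> e"
    
    by (rule is_radius_class_S_AB[OF n AB R1(1,2), folded x_def e_def, unfolded em, folded \<beta>_def \<delta>_def])
      (use x that in auto)
  show ?thesis
  proof (cases "0 \<le> B")
    case True
    \<comment> \<open>For \<open>B \<ge> 0\<close> the right bound is automatic, because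
      \<open>\<delta> \<le> 1 < e\<close> and \<open>x \<le> 1\<close>.\<close>
    have "x * \<delta> \<le> e"
    proof (cases "0 \<le> \<delta>")
      case True
      have "0 \<le> (e + 1) * B" using \<open>0 \<le> B\<close> e1 by simp
      then have "\<delta> \<le> 1" using AB by (simp add: \<delta>_def)
      then have "x * \<delta> \<le> 1 * 1" using x True by (intro mult_mono) auto
      then show ?thesis using e1 by simp
    next
      case False
      then have "x * \<delta> \<le> 0" using x by (simp add: mult_nonneg_nonpos)
      then show ?thesis using e1 by linarith
    qed
    then show ?thesis using radius1 True by simp
  next
    case B: False
    \<comment> \<open>\<open>c\<close> is \<open>1 + sinh 1\<close>, the centre of the target disk;
      \<open>c - 1\<close> and \<open>D\<close> below are numerator and denominator of
      \<open>r1^(2n)\<close>.\<close>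
    define c where "c = (e\<^sup>2 + 2 * e - 1) / (2 * e)"
    have c1: "c - 1 = (e\<^sup>2 - 1) / (2 * e)" using e1 by (simp add: c_def field_simps)
    have c2: "2 * c = 2 + e - 1 / e" using e1 by (simp add: c_def field_simps power2_eq_square)
    have c0: "0 < c - 1" using e1 by (simp add: c1 power2_eq_square less_1_mult)
    define D where "D = c * B\<^sup>2 - A * B"
    have D: "0 < D"
    proof -
      have "0 < c * B\<^sup>2" using c0 B by simp
      moreover have "A * B \<le> 0" using AB B by (simp add: mult_nonneg_nonpos)
      ultimately show ?thesis by (simp add: D_def)
    qed
    have r1: "r1 = ((c - 1) / D) powr (1 / (2 * real n))"
      unfolding c1 D_def unfolding c_def r1_def e_def by (rule refl)
    have "R1 \<le> r1 \<longleftrightarrow> R1 ^ (2 * n) \<le> r1 ^ (2 * n)"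
      by (rule power_mono_iff[symmetric]) (use R1 n in \<open>auto simp: r1\<close>)
    also have "r1 ^ (2 * n) = (c - 1) / D"
      using c0 D n by (simp add: r1 powr_power)
    also have "R1 ^ (2 * n) = x\<^sup>2" by (simp add: x_def power_mult[symmetric] mult.commute)
    finally have r1_iff: "R1 \<le> r1 \<longleftrightarrow> x\<^sup>2 * D \<le> c - 1" using D by (simp add: le_divide_eq)
    have \<delta>: "0 < \<delta>"
    proof -
      have "(e + 1) * B < 0" using B e1 by (simp add: mult_less_0_iff)
      then show ?thesis using AB by (simp add: \<delta>_def)
    qed
    \<comment> \<open>Twice the centre \<open>(1 - A B y\<^sup>2) / (1 - B\<^sup>2 y\<^sup>2)\<close> of the image disk is the sum of its
      real end points, compared here with \<open>2 c = (1 - 1/e) + (1 + e)\<close> after clearing denominators.\<close>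
    have centre: "2 * (c - 1 - y\<^sup>2 * D) = (e - y * \<delta>) * (1 - B * y) - (1 / e - y * \<beta>) * (1 + B * y)" for y
    proof -
      have "2 * (c - 1 - y\<^sup>2 * D) = 2 * c - 2 - y\<^sup>2 * ((2 * c) * B\<^sup>2 - 2 * A * B)"
        by (simp add: D_def algebra_simps)
      then show ?thesis
        unfolding c2 \<beta>_def \<delta>_def by (simp add: power2_eq_square algebra_simps add_divide_distrib)
    qed
    show ?thesis
    proof (cases "R1 \<le> r1")
      case True
      \<comment> \<open>A nonnegative left slack together with a centre not beyond \<open>c\<close>
        forces a nonnegative right slack, by \<open>centre\<close>.\<close>
      have "B * x \<le> 0" "- 1 * 1 \<le> B * x"
        using AB B x mult_mono[of "- B" 1 x 1] by (auto simp: mult_nonpos_nonneg)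
      then have "0 \<le> (1 / e - x * \<beta>) * (1 + B * x)" and pos: "0 < 1 - B * x"
        using x by (auto intro!: mult_nonneg_nonneg)
      moreover have "0 \<le> 2 * (c - 1 - x\<^sup>2 * D)" using True r1_iff by simp
      ultimately have "0 \<le> (e - x * \<delta>) * (1 - B * x)" using centre[of x] by linarith
      then have "x * \<delta> \<le> e" using pos by (simp add: zero_le_mult_iff)
      then show ?thesis using radius1 True by simp
    next
      case False
      define y where "y = R2 ^ n"
      have R2: "0 < R2" "R2 \<le> 1" "y = min 1 (e / \<delta>)"
        using \<delta> e1 n by (auto simp: R2_def y_def e_def \<delta>_def min_powr_power)
      have y: "0 < y" "y \<le> 1" using R2 \<delta> e1 by auto
      have "y \<le> e / \<delta>" using R2(3) by simp
      then have y\<delta>: "y * \<delta> \<le> e" using \<delta> by (simp only: le_divide_eq if_True)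
      have "y = 1 \<longrightarrow> R2 = 1"
        using R2 n power_eq_1_iff[of R2 n] by (auto simp: y_def)
      then have sharp: "R2 = 1 \<or> y * \<delta> = e" using R2(3) \<delta> by (auto simp: min_def split: if_splits)
      \<comment> \<open>Up to \<open>x\<close> the left bound is inherited. Beyond \<open>x\<close>
        the centre lies past the threshold, so \<open>centre\<close> makes the left slack
        positive.\<close>
      have "y * \<beta> \<le> 1 / e"
      proof (cases "y \<le> x")
        case True
        then have "y * \<beta> \<le> x * \<beta>" using \<beta> by simp
        then show ?thesis using x by simp
      next
        case larger: False
        then have "x\<^sup>2 * D \<le> y\<^sup>2 * D" using x D by (intro mult_right_mono power_mono) auto
        then have neg: "2 * (c - 1 - y\<^sup>2 * D) < 0" using False r1_iff by simp
        have "B * y \<le> 0" "- 1 * 1 \<le> B * y"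
          using AB B y mult_mono[of "- B" 1 y 1] by (auto simp: mult_nonpos_nonneg)
        then have "0 \<le> (e - y * \<delta>) * (1 - B * y)" and pos: "0 \<le> 1 + B * y"
          using y\<delta> by (auto intro!: mult_nonneg_nonneg)
        then have "0 < (1 / e - y * \<beta>) * (1 + B * y)" using centre[of y] neg by linarith
        then show ?thesis using pos by (auto simp: zero_less_mult_iff)
      qed
      then have "is_radius (class_S_wp n) (class_S_AB n A B) R2"
        by (rule is_radius_class_S_AB[OF n AB R2(1,2), folded y_def e_def, unfolded em, folded \<beta>_def \<delta>_def])
          (use y\<delta> sharp in auto)
      then show ?thesis using False B by simp
    qed
  qed
qed

text \<open>The left end point is critical: its bound holds with equality. The right bound reduces
  to \<open>1 + e \<le> e^2\<close>, for which \<open>e \<ge> 2\<close> suffices.\<close>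

lemma is_radius_class_Sstar: "is_radius (class_S_wp 1) class_Sstar (1 / (2 * exp 1 - 1))"
  unfolding class_Sstar_eq
proof (rule is_radius_class_S_AB)
  define e :: real where "e = exp 1"
  have e: "2 \<le> e" using exp_ge_add_one_self[of 1] by (simp add: e_def)
  have em: "exp (-1) = 1 / e" by (simp add: e_def exp_minus inverse_eq_divide)
  have eq: "1 / (2 * e - 1) * (1 - (1 - 1 / e) * - 1) = 1 / e"
    using e by (simp add: field_simps)
  have "2 * (e * 2) \<le> e * (e * 2)" using e by (intro mult_right_mono) auto
  then have "2 + e * 2 \<le> e * (e * 2)" using e by linarith
  then show "(1 / (2 * exp 1 - 1)) ^ 1 * (1 - (exp 1 + 1) * - 1) \<le> exp (1 :: real)"
    unfolding e_def[symmetric] using e by (simp add: field_simps)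
  show "(1 / (2 * exp 1 - 1)) ^ 1 * (1 - (1 - exp (- 1)) * - 1) \<le> exp (- 1 :: real)"
    "1 / (2 * exp 1 - 1) = (1 :: real)
      \<or> (1 / (2 * exp 1 - 1)) ^ 1 * (1 - (1 - exp (- 1)) * - 1) = exp (- 1 :: real)
      \<or> (1 / (2 * exp 1 - 1)) ^ 1 * (1 - (exp 1 + 1) * - 1) = exp (1 :: real)"
    unfolding e_def[symmetric] em using eq by auto
  show "0 < 1 / (2 * exp 1 - (1 :: real))" "1 / (2 * exp 1 - 1) \<le> (1 :: real)"
    unfolding e_def[symmetric] using e by auto
qed auto

theorem mainTheorem9:
  fixes n :: nat and A B :: real
  assumes "n \<ge> 1"
  defines "R1 \<equiv> min 1 (((1 / exp 1) / (A - (1 - 1 / exp 1) * B)) powr (1 / real n))"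
      and "R2 \<equiv> min 1 ((exp 1 / (A - (exp 1 + 1) * B)) powr (1 / real n))"
      and "r1 \<equiv> (((exp 1 ^ 2 - 1) / (2 * exp 1)) /
                 (((exp 1 ^ 2 + 2 * exp 1 - 1) / (2 * exp 1)) * B ^ 2 - A * B)) powr (1 / (2 * real n))"
  shows "(0 \<le> B \<and> B < A \<and> A \<le> 1 \<longrightarrow> is_radius (class_S_wp n) (class_S_AB n A B) R1)
       \<and> (-1 \<le> B \<and> B < 0 \<and> 0 \<le> A \<and> A \<le> 1 \<longrightarrow>
            is_radius (class_S_wp n) (class_S_AB n A B) (if R1 \<le> r1 then R1 else R2))
       \<and> is_radius (class_S_wp 1) class_Sstar (1 / (2 * exp 1 - 1))"
proof (intro conjI impI)
  assume "0 \<le> B \<and> B < A \<and> A \<le> 1"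
  then show "is_radius (class_S_wp n) (class_S_AB n A B) R1"
    using is_radius_class_S_AB_cases[OF assms(1), of B A] by (simp add: R1_def)
next
  assume "-1 \<le> B \<and> B < 0 \<and> 0 \<le> A \<and> A \<le> 1"
  then show "is_radius (class_S_wp n) (class_S_AB n A B) (if R1 \<le> r1 then R1 else R2)"
    using is_radius_class_S_AB_cases[OF assms(1), of B A]
    unfolding R1_def[symmetric] R2_def[symmetric] r1_def[symmetric] by simp
qed (rule is_radius_class_Sstar)

end
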